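(* Let $A$ be a complex (associative) algebra with unit $\mathbf{1}$, let $n\geq 2$, and let $T$ be a linear map on the matrix algebra $M_{n}(A)$. Suppose that every derivation on $A$ is inner. Then $T$ is anti-derivable at zero if, and only if, there exist $u,v \in M_{n}(A)$ such that $u-v \in \mathcal{Z}(M_{n}(A))$, $T(a) = a u - v a$ for all $a\in M_n(A)$, and $[b a, u ] + 2 (u-v) b a = 0$ for all $a,b \in M_n(A)$ with $a b = 0$.
   Context: $[x,y]=xy-yx$, and $\mathcal{Z}(B)$ denotes the center of an algebra $B$. A derivation on $A$ is a linear map $d:A\to A$ with $d(ab)=d(a)b+ad(b)$ for all $a,b\in A$; it is inner if there is $x_0\in A$ with $d(a)=ax_0-x_0a$ for all $a\in A$. A linear map $T:B\to B$ on an algebra $B$ is anti-derivable at zero if $T(b) a + b T(a)=0$ whenever $a,b\in B$ and $ab=0$. *)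

theory Defs
  imports "HOL-Analysis.Analysis"
begin

locale complex_unital_algebra = vector_space smul
  for smul :: "complex \<Rightarrow> 'a::ring_1 \<Rightarrow> 'a" +
  assumes smul_mult_left: "smul c (a * b) = smul c a * b"
    and smul_mult_right: "smul c (a * b) = a * smul c b"

definition derivation :: "(complex \<Rightarrow> 'a::ring_1 \<Rightarrow> 'a) \<Rightarrow> ('a \<Rightarrow> 'a) \<Rightarrow> bool" where
  "derivation smul d \<longleftrightarrow>
     Vector_Spaces.linear smul smul d \<and> (\<forall>a b. d (a * b) = d a * b + a * d b)"

definition is_inner :: "('a::ring_1 \<Rightarrow> 'a) \<Rightarrow> bool" where
  "is_inner d \<longleftrightarrow> (\<exists>x0. \<forall>a. d a = a * x0 - x0 * a)"

text \<open>The type class product of the vector type is componentwise, so it is not the product of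
  the matrix algebra. The following notions for an algebra \<open>B\<close> therefore take the product
  as an argument; for matrices it is \<open>(**)\<close>.\<close>

definition commutator :: "('b \<Rightarrow> 'b \<Rightarrow> 'b::ab_group_add) \<Rightarrow> 'b \<Rightarrow> 'b \<Rightarrow> 'b" where
  "commutator mul x y = mul x y - mul y x"

definition algebra_center :: "('b \<Rightarrow> 'b \<Rightarrow> 'b) \<Rightarrow> 'b set" where
  "algebra_center mul = {z. \<forall>x. mul z x = mul x z}"

definition anti_derivable_at_zero ::
    "('b \<Rightarrow> 'b \<Rightarrow> 'b::ab_group_add) \<Rightarrow> ('b \<Rightarrow> 'b) \<Rightarrow> bool" where
  "anti_derivable_at_zero mul T \<longleftrightarrow>
     (\<forall>a b. mul a b = 0 \<longrightarrow> mul (T b) a + mul b (T a) = 0)"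

definition matrix_scale :: "(complex \<Rightarrow> 'a \<Rightarrow> 'a) \<Rightarrow> complex \<Rightarrow> 'a^'n^'m \<Rightarrow> 'a^'n^'m" where
  "matrix_scale smul c M = (\<chi> i j. smul c (M $ i $ j))"

lemma (in complex_unital_algebra) vector_space_matrix_scale:
  "vector_space (matrix_scale smul :: complex \<Rightarrow> 'a^'n^'m \<Rightarrow> 'a^'n^'m)"
  by unfold_locales
    (simp_all add: matrix_scale_def vec_eq_iff scale_right_distrib scale_left_distrib)

end

theory Submission
  imports Defs
begin

text \<open>
  A linear map \<open>T\<close> on \<open>M\<^sub>n(A)\<close>, \<open>n \<ge> 2\<close>, that is anti-derivable at zero is in fact
  zero, so for the forward implication \<open>u = v = 0\<close> will do. To see this, write
  \<open>E i j x\<close> for the matrix with the single entry \<open>x\<close> at position \<open>(i, j)\<close>. As \<open>T\<close> is additive,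
  it suffices to look at \<open>T (E i j x)\<close>.

  The products \<open>E i j x ** E k l y = 0\<close> with \<open>j \<noteq> k\<close> show that \<open>T (E k l y) = E k l (t\<^sub>k\<^sub>l(y))\<close>
  for additive maps \<open>t\<^sub>k\<^sub>l\<close> on \<open>A\<close>, and that these satisfy \<open>t\<^sub>k\<^sub>l(y) x + y t\<^sub>l\<^sub>j(x) = 0\<close> whenever
  \<open>j \<noteq> k\<close> (lemmas \<open>off_position\<close> and \<open>entry_relation\<close>). Hence all \<open>t\<^sub>k\<^sub>l\<close> are determined by the
  elements \<open>t\<^sub>i\<^sub>i(1)\<close>. These relations alone would still allow \<open>t\<^sub>i\<^sub>i(x) = c x\<close> and
  \<open>t\<^sub>i\<^sub>j(x) = - c x\<close> for \<open>i \<noteq> j\<close>, with \<open>c\<close> central. A product that vanishes by cancellation,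
  \<open>(E i i 1 + E i j 1) ** (E i i 1 - E j i 1) = 0\<close>, excludes this: it gives \<open>2 t\<^sub>i\<^sub>i(1) = 0\<close>
  (lemma \<open>diagonal_entry_eq_0\<close>).

  Conversely, if \<open>T(a) = a u - v a\<close> with \<open>u - v\<close> central, then
  \<open>T(b) a + b T(a) = [b a, u] + 2 (u - v) b a\<close> holds identically.
\<close>

lemma matrix_add_rdistrib:
  fixes B C :: "'a::semiring_1^'n^'m" and A :: "'a^'k^'n"
  shows "(B + C) ** A = B ** A + C ** A"
  by (simp add: vec_eq_iff matrix_matrix_mult_def sum.distrib distrib_right)

lemma matrix_diff_ldistrib:
  fixes A :: "'a::ring_1^'n^'m" and B C :: "'a^'k^'n"
  shows "A ** (B - C) = A ** B - A ** C"
  by (simp add: vec_eq_iff matrix_matrix_mult_def sum_subtractf right_diff_distrib)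

lemma matrix_diff_rdistrib:
  fixes B C :: "'a::ring_1^'n^'m" and A :: "'a^'k^'n"
  shows "(B - C) ** A = B ** A - C ** A"
  by (simp add: vec_eq_iff matrix_matrix_mult_def sum_subtractf left_diff_distrib)

definition elementary_matrix :: "'n \<Rightarrow> 'm \<Rightarrow> 'a \<Rightarrow> 'a::zero^'m^'n" where
  "elementary_matrix i j x = (\<chi> p q. if p = i \<and> q = j then x else 0)"

lemma elementary_matrix_nth [simp]:
  "elementary_matrix i j x $ p $ q = (if p = i \<and> q = j then x else 0)"
  by (simp add: elementary_matrix_def)

lemma matrix_mult_elementary_nth:
  fixes M :: "'a::semiring_1^'n^'m"
  shows "(M ** elementary_matrix i j x) $ p $ q = (if q = j then M $ p $ i * x else 0)"
proof -
  have "(M ** elementary_matrix i j x) $ p $ q =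
      (\<Sum>k\<in>UNIV. if k = i then (if q = j then M $ p $ k * x else 0) else 0)"
    unfolding matrix_matrix_mult_def vec_lambda_beta by (rule sum.cong) auto
  then show ?thesis by simp
qed

lemma elementary_mult_matrix_nth:
  fixes M :: "'a::semiring_1^'n^'m"
  shows "(elementary_matrix k l y ** M) $ p $ q = (if p = k then y * M $ l $ q else 0)"
proof -
  have "(elementary_matrix k l y ** M) $ p $ q =
      (\<Sum>i\<in>UNIV. if i = l then (if p = k then y * M $ i $ q else 0) else 0)"
    unfolding matrix_matrix_mult_def vec_lambda_beta by (rule sum.cong) auto
  then show ?thesis by simp
qed

lemma matrix_eq_sum_elementary:
  fixes M :: "'a::comm_monoid_add^'m^'n"
  shows "M = (\<Sum>i\<in>UNIV. \<Sum>j\<in>UNIV. elementary_matrix i j (M $ i $ j))"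
proof -
  have "(\<Sum>i\<in>UNIV. \<Sum>j\<in>UNIV. elementary_matrix i j (M $ i $ j)) $ p $ q = M $ p $ q" for p q
  proof -
    have "(\<Sum>i\<in>UNIV. \<Sum>j\<in>UNIV. elementary_matrix i j (M $ i $ j)) $ p $ q =
        (\<Sum>i\<in>UNIV. if i = p then (\<Sum>j\<in>UNIV. if j = q then M $ i $ j else 0) else 0)"
      unfolding sum_component by (rule sum.cong) (auto intro!: sum.neutral)
    then show ?thesis by simp
  qed
  then show ?thesis by (simp add: vec_eq_iff)
qed

context
  fixes T :: "'a::ring_1^'n^'n \<Rightarrow> 'a^'n^'n"
  assumes two_indices: "CARD('n) \<ge> 2"
    and add: "Modules.additive T"
    and anti: "anti_derivable_at_zero (**) T"
begin

lemma obtain_other_index: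
  obtains j :: 'n where "j \<noteq> k"
proof -
  have "\<exists>j. j \<noteq> k"
  proof (rule ccontr)
    assume "\<not> ?thesis"
    then have "(UNIV :: 'n set) = {k}" by auto
    then have "CARD('n) = card {k}" by (rule arg_cong)
    with two_indices show False by simp
  qed
  then show ?thesis using that by blast
qed

text \<open>The entry at \<open>(p, q)\<close> of the identity at the zero product
  \<open>elementary_matrix i j x ** elementary_matrix k l y\<close>.\<close>

lemma elementary_identity:
  assumes "j \<noteq> k"
  shows "(if q = j then T (elementary_matrix k l y) $ p $ i * x else 0) +
    (if p = k then y * T (elementary_matrix i j x) $ l $ q else 0) = 0"
proof -
  have "elementary_matrix i j x ** elementary_matrix k l y = 0"
    using assms by (simp add: vec_eq_iff matrix_mult_elementary_nth)
  then have "T (elementary_matrix k l y) ** elementary_matrix i j x +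
      elementary_matrix k l y ** T (elementary_matrix i j x) = 0"
    using anti by (simp add: anti_derivable_at_zero_def)
  then have "(T (elementary_matrix k l y) ** elementary_matrix i j x +
      elementary_matrix k l y ** T (elementary_matrix i j x)) $ p $ q = 0"
    by simp
  then show ?thesis
    by (simp only: vector_add_component matrix_mult_elementary_nth elementary_mult_matrix_nth)
qed

text \<open>In a row other than \<open>k\<close>, the identity for a product with right factor
  \<open>elementary_matrix k l y\<close> keeps only its first summand; in a column other than \<open>l\<close>, the
  identity for a product with left factor \<open>elementary_matrix k l y\<close> keeps only its second one.
  With entry \<open>1\<close> in the other factor, the remaining summand is the entry of
  \<open>T (elementary_matrix k l y)\<close> in question. A second index is needed to make the products
  zero.\<close>

lemma off_position:
  assumes "p \<noteq> k \<or> q \<noteq> l"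
  shows "T (elementary_matrix k l y) $ p $ q = 0"
proof (cases "p = k")
  case False
  obtain j where "j \<noteq> k" by (rule obtain_other_index)
  from elementary_identity[OF this, of j l y p q 1] False show ?thesis by simp
next
  case True
  with assms have "q \<noteq> l" by simp
  obtain m where "m \<noteq> l" by (rule obtain_other_index)
  then have "l \<noteq> m" by simp
  from elementary_identity[OF this, of q p 1 m k y] \<open>q \<noteq> l\<close> show ?thesis by simp
qed

lemma entry_relation:
  assumes "j \<noteq> k"
  shows "T (elementary_matrix k l y) $ k $ l * x + y * T (elementary_matrix l j x) $ l $ j = 0"
  using elementary_identity[OF assms, of j l y k l x] by simp

text \<open>For \<open>j \<noteq> i\<close>, the product of \<open>a = E i i 1 + E i j 1\<close> and \<open>b = E i i 1 - E j i 1\<close>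
  vanishes by cancellation, and both \<open>T(b) a\<close> and \<open>b T(a)\<close> have \<open>t\<^sub>i\<^sub>i(1)\<close> at position
  \<open>(i, i)\<close>: there the other elementary summands contribute nothing.\<close>

lemma diagonal_entry_eq_0:
  assumes two_torsion_free: "\<And>x::'a. x + x = 0 \<Longrightarrow> x = 0"
  shows "T (elementary_matrix i i 1) $ i $ i = 0"
proof -
  obtain j where j: "j \<noteq> i" by (rule obtain_other_index)
  let ?E = "\<lambda>i j. elementary_matrix i j (1::'a)"
  let ?a = "?E i i + ?E i j" and ?b = "?E i i - ?E j i"
  have "?a ** ?b = 0"
    using j by (simp add: vec_eq_iff matrix_add_rdistrib elementary_mult_matrix_nth)
  then have "(T ?b ** ?a + ?b ** T ?a) $ i $ i = 0"
    using anti by (simp add: anti_derivable_at_zero_def)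
  moreover have "(T ?b ** ?a) $ i $ i = T (?E i i) $ i $ i"
    using j by (simp add: matrix_add_ldistrib matrix_mult_elementary_nth
        Modules.additive.diff[OF add] off_position)
  moreover have "(?b ** T ?a) $ i $ i = T (?E i i) $ i $ i"
    using j by (simp add: matrix_diff_rdistrib elementary_mult_matrix_nth
        Modules.additive.add[OF add] off_position)
  ultimately have "T (?E i i) $ i $ i + T (?E i i) $ i $ i = 0"
    by (simp only: vector_add_component)
  then show ?thesis by (rule two_torsion_free)
qed

text \<open>The vanishing of \<open>t\<^sub>l\<^sub>l(1)\<close> spreads by \<open>t\<^sub>k\<^sub>l(y) x + y t\<^sub>l\<^sub>j(x) = 0\<close> at \<open>x = 1\<close>: taking
  \<open>j = l \<noteq> k\<close> gives the off-diagonal positions, and these then give the diagonal ones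
  with \<open>l = k \<noteq> j\<close>.\<close>

lemma anti_derivable_at_zero_imp_eq_0:
  assumes two_torsion_free: "\<And>x::'a. x + x = 0 \<Longrightarrow> x = 0"
  shows "T M = 0"
proof -
  have off_diagonal: "T (elementary_matrix k l y) $ k $ l = 0" if "k \<noteq> l" for k l y
    using entry_relation[of l k l y 1] that diagonal_entry_eq_0[OF two_torsion_free] by simp
  have diagonal: "T (elementary_matrix k k y) $ k $ k = 0" for k y
  proof -
    obtain j where "j \<noteq> k" by (rule obtain_other_index)
    then show ?thesis using entry_relation[of j k k y 1] off_diagonal[of k j 1] by simp
  qed
  have elementary: "T (elementary_matrix k l y) = 0" for k l y
  proof -
    have "T (elementary_matrix k l y) $ p $ q = 0" for p q
      using off_position[of p k q l y] off_diagonal[of k l y] diagonal[of k y]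
      by (cases "p = k \<and> q = l"; cases "k = l") auto
    then show ?thesis by (simp add: vec_eq_iff)
  qed
  have "T M = (\<Sum>i\<in>UNIV. \<Sum>j\<in>UNIV. T (elementary_matrix i j (M $ i $ j)))"
    by (subst matrix_eq_sum_elementary[of M]) (simp add: Modules.additive.sum[OF add])
  then show ?thesis by (simp add: elementary)
qed

end

text \<open>The left-hand side is \<open>b (u - v) a + b a u - v b a\<close>. The central factor moves to the
  front, and \<open>b a u - v b a\<close> is \<open>[b a, u] + (u - v) b a\<close>.\<close>

lemma anti_derivation_identity:
  fixes u v a b :: "'a::ring_1^'n^'n"
  assumes "u - v \<in> algebra_center (**)"
  shows "(b ** u - v ** b) ** a + b ** (a ** u - v ** a) =
    commutator (**) (b ** a) u + ((u - v) ** (b ** a) + (u - v) ** (b ** a))"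
proof -
  have "(u - v) ** b = b ** (u - v)"
    using assms by (simp add: algebra_center_def)
  then have "(u - v) ** (b ** a) = b ** (u - v) ** a"
    by (simp add: matrix_mul_assoc)
  then have "u ** b ** a - v ** b ** a = b ** u ** a - b ** v ** a"
    by (simp only: matrix_diff_ldistrib matrix_diff_rdistrib matrix_mul_assoc)
  then have *: "b ** u ** a = b ** v ** a + (u ** b ** a - v ** b ** a)"
    by simp
  show ?thesis
    unfolding commutator_def matrix_diff_ldistrib matrix_diff_rdistrib matrix_mul_assoc *
    by simp
qed

theorem corollary2p4:
  fixes smul :: "complex \<Rightarrow> 'a::ring_1 \<Rightarrow> 'a"
    and T :: "'a^'n^'n \<Rightarrow> 'a^'n^'n"
  assumes "complex_unital_algebra smul"
    and "CARD('n) \<ge> 2"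
    and "Vector_Spaces.linear (matrix_scale smul) (matrix_scale smul) T"
    and "\<forall>d. derivation smul d \<longrightarrow> is_inner d"
  shows "anti_derivable_at_zero (**) T \<longleftrightarrow>
    (\<exists>u v :: 'a^'n^'n.
       u - v \<in> algebra_center (**) \<and>
       (\<forall>a. T a = a ** u - v ** a) \<and>
       (\<forall>(a :: 'a^'n^'n) (b :: 'a^'n^'n). a ** b = 0 \<longrightarrow>
          commutator (**) (b ** a) u + matrix_scale smul 2 ((u - v) ** (b ** a)) = 0))"
    (is "_ \<longleftrightarrow> ?R")
proof -
  interpret complex_unital_algebra smul by fact
  have smul_2: "smul 2 x = x + x" for x
    using scale_left_distrib[of 1 1 x] by simp
  have scale_2: "matrix_scale smul 2 M = M + M" for M :: "'a^'n^'n"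
    by (simp add: vec_eq_iff matrix_scale_def smul_2)
  show ?thesis
  proof
    assume anti: "anti_derivable_at_zero (**) T"
    have "Modules.additive T"
      using assms(3) by (simp add: Modules.additive_def Vector_Spaces.linear_iff)
    moreover have "x = 0" if "x + x = 0" for x :: 'a
      using that scale_eq_0_iff[of 2 x] by (simp add: smul_2)
    ultimately have "T a = 0" for a
      by (rule anti_derivable_at_zero_imp_eq_0[OF assms(2) _ anti])
    then show ?R
      by (intro exI[of _ 0])
        (simp add: algebra_center_def commutator_def scale_2)
  next
    assume ?R
    then obtain u v where uv: "u - v \<in> algebra_center (**)" "\<forall>a. T a = a ** u - v ** a"
      "\<forall>(a :: 'a^'n^'n) b. a ** b = 0 \<longrightarrow>
        commutator (**) (b ** a) u + matrix_scale smul 2 ((u - v) ** (b ** a)) = 0"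
      by (elim exE conjE)
    show "anti_derivable_at_zero (**) T"
      unfolding anti_derivable_at_zero_def
    proof (intro allI impI)
      fix a b :: "'a^'n^'n"
      assume "a ** b = 0"
      have "T b ** a + b ** T a = (b ** u - v ** b) ** a + b ** (a ** u - v ** a)"
        by (simp only: uv(2))
      also have "\<dots> = commutator (**) (b ** a) u + matrix_scale smul 2 ((u - v) ** (b ** a))"
        by (simp only: anti_derivation_identity[OF uv(1)] scale_2)
      also have "\<dots> = 0"
        using uv(3) \<open>a ** b = 0\<close> by (elim allE impE)
      finally show "T b ** a + b ** T a = 0" .
    qed
  qed
qed

end
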